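(* For every positive integer $n$, $$t(n)\le \left[\frac{[\sqrt n]-1}{2}\right]+[\sqrt n]+7,$$ where $[x]$ denotes the greatest integer not exceeding $x$.
   Context: A $\mathbb Z$-lattice is a free $\mathbb Z$-module of finite rank equipped with a positive definite symmetric bilinear form with values in $\mathbb Z$; $Q(\bm x)=B(\bm x,\bm x)$. An integer $m$ is represented by $L$ if $m=Q(\bm x)$ for some $\bm x\in L$. For a positive integer $n$, $\mathcal T(n)$ is the set of all integers $\ge n$. A $\mathbb Z$-lattice $L$ is tight $\mathcal T(n)$-universal if the set of nonzero integers represented by $L$ is exactly $\mathcal T(n)$. $t(n)$ denotes the smallest rank of a tight $\mathcal T(n)$-universal $\mathbb Z$-lattice. *)

theory Defs
  imports Complex_Main "HOL-Library.Extended_Nat" "HOL-Library.Poly_Mapping"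
begin

text \<open>
  A Z-lattice of rank r: a submodule L of an ambient Z-module that is free of rank r, i.e. has
  a basis of r elements, with a positive definite symmetric bilinear form B on L with
  integer values.  Nothing is assumed about B outside L.
\<close>

locale Z_lattice = module scale
  for scale :: "int \<Rightarrow> 'a::ab_group_add \<Rightarrow> 'a" +
  fixes L :: "'a set" and r :: nat and B :: "'a \<Rightarrow> 'a \<Rightarrow> int"
  assumes free: "\<exists>b. finite b \<and> card b = r \<and> independent b \<and> span b = L"
    and sym: "\<lbrakk>x \<in> L; y \<in> L\<rbrakk> \<Longrightarrow> B x y = B y x"
    and add_left: "\<lbrakk>x \<in> L; y \<in> L; z \<in> L\<rbrakk> \<Longrightarrow> B (x + y) z = B x z + B y z"
    and scale_left: "\<lbrakk>x \<in> L; y \<in> L\<rbrakk> \<Longrightarrow> B (scale c x) y = c * B x y"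
    and pos_def: "\<lbrakk>x \<in> L; x \<noteq> 0\<rbrakk> \<Longrightarrow> B x x > 0"

definition represented_by :: "int \<Rightarrow> 'a set \<Rightarrow> ('a \<Rightarrow> 'a \<Rightarrow> int) \<Rightarrow> bool" where
  "represented_by m L B \<longleftrightarrow> (\<exists>x\<in>L. m = B x x)"

definition tight_universal :: "nat \<Rightarrow> 'a set \<Rightarrow> ('a \<Rightarrow> 'a \<Rightarrow> int) \<Rightarrow> bool" where
  "tight_universal n L B \<longleftrightarrow> {m. m \<noteq> 0 \<and> represented_by m L B} = {int n..}"

text \<open>
  The smallest rank of a tight T(n)-universal Z-lattice, taken in the extended naturals so that
  it would be infinite if there were no such lattice.  The lattices range over the submodules
  of the free Z-module with basis the natural numbers; every Z-lattice, whatever its ambient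
  module, is isometric to one of these, and the lemma at the end shows that the minimum does
  not depend on this choice.
\<close>

definition min_tight_rank :: "nat \<Rightarrow> enat" where
  "min_tight_rank n =
     Inf {enat r | r (L :: (nat \<Rightarrow>\<^sub>0 int) set) B.
            Z_lattice frag_cmul L r B \<and> tight_universal n L B}"

lemma module_frag_cmul: "module (frag_cmul :: int \<Rightarrow> ('a \<Rightarrow>\<^sub>0 int) \<Rightarrow> _)"
  by unfold_locales (simp_all add: frag_cmul_distrib frag_cmul_distrib2)

lemma Z_lattice_transfer:
  fixes scale :: "int \<Rightarrow> 'a::ab_group_add \<Rightarrow> 'a"
  assumes "Z_lattice scale L r B"
  obtains L' :: "(nat \<Rightarrow>\<^sub>0 int) set" and \<phi> :: "(nat \<Rightarrow>\<^sub>0 int) \<Rightarrow> 'a"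
  where "Z_lattice frag_cmul L' r (\<lambda>x y. B (\<phi> x) (\<phi> y))" and "bij_betw \<phi> L' L"
proof -
  interpret Z_lattice scale L r B by fact
  interpret F: module "frag_cmul :: int \<Rightarrow> (nat \<Rightarrow>\<^sub>0 int) \<Rightarrow> _" by (rule module_frag_cmul)
  obtain b where b: "finite b" "card b = r" "independent b" "span b = L"
    using free by blast
  obtain f where f: "bij_betw f {..<r} b"
    using b ex_bij_betw_nat_finite[of b] by (auto simp: atLeast0LessThan)
  define g where "g = the_inv_into {..<r} f"
  have g: "g (f i) = i" if "i < r" for i
    using f that unfolding g_def bij_betw_def by (simp add: the_inv_into_f_f)
  define \<phi> where "\<phi> = (\<lambda>x::nat \<Rightarrow>\<^sub>0 int. \<Sum>i<r. scale (Poly_Mapping.lookup x i) (f i))"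
  define E where "E = (frag_of :: nat \<Rightarrow> nat \<Rightarrow>\<^sub>0 int) ` {..<r}"
  have inj: "inj_on (frag_of :: nat \<Rightarrow> nat \<Rightarrow>\<^sub>0 int) {..<r}"
    by (auto simp: inj_on_def frag_of_eq)
  have cE: "finite E" "card E = r"
    using inj by (auto simp: E_def card_image)
  have comb: "Poly_Mapping.lookup (\<Sum>v\<in>E. frag_cmul (u v) v) i
      = (if i < r then u (frag_of i) else 0)" for u i
    unfolding E_def by (subst sum.reindex[OF inj]) (simp add: lookup_sum if_distrib cong: if_cong)
  have spE: "F.span E = {x. \<forall>i\<ge>r. Poly_Mapping.lookup x i = 0}"
  proof (intro set_eqI iffI)
    fix x assume "x \<in> F.span E"
    then show "x \<in> {x. \<forall>i\<ge>r. Poly_Mapping.lookup x i = 0}"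
      unfolding F.span_finite[OF cE(1)] by (auto simp: comb)
  next
    fix x :: "nat \<Rightarrow>\<^sub>0 int" assume x: "x \<in> {x. \<forall>i\<ge>r. Poly_Mapping.lookup x i = 0}"
    define u where "u v = (\<Sum>i<r. if v = frag_of i then Poly_Mapping.lookup x i else 0)"
      for v :: "nat \<Rightarrow>\<^sub>0 int"
    have u: "u (frag_of i) = Poly_Mapping.lookup x i" if "i < r" for i
      using that by (simp add: u_def frag_of_eq)
    have "x = (\<Sum>v\<in>E. frag_cmul (u v) v)"
      using x by (intro poly_mapping_eqI) (auto simp: comb u)
    then show "x \<in> F.span E"
      unfolding F.span_finite[OF cE(1)] by blast
  qed
  have indE: "F.independent E"
    unfolding F.dependent_finite[OF cE(1)]
  proof (intro notI, elim exE conjE)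
    fix u assume u: "\<exists>v\<in>E. u v \<noteq> 0" "(\<Sum>v\<in>E. frag_cmul (u v) v) = 0"
    then obtain i where "i < r" "u (frag_of i) \<noteq> 0" by (auto simp: E_def)
    with comb[of u i] u(2) show False by simp
  qed
  have \<phi>_add: "\<phi> (x + y) = \<phi> x + \<phi> y" for x y
    by (simp add: \<phi>_def lookup_add scale_left_distrib sum.distrib)
  have \<phi>_scale: "\<phi> (frag_cmul c x) = scale c (\<phi> x)" for c x
    by (simp add: \<phi>_def scale_sum_right)
  have \<phi>_alt: "\<phi> x = (\<Sum>v\<in>b. scale (Poly_Mapping.lookup x (g v)) v)" for x
    unfolding \<phi>_def
    by (subst sum.reindex_bij_betw[OF f, symmetric]) (simp add: g)
  have \<phi>_L: "\<phi> x \<in> L" for x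
    unfolding \<phi>_alt b(4)[symmetric] by (intro span_sum span_scale span_base)
  have \<phi>_0: "x = 0" if "x \<in> F.span E" "\<phi> x = 0" for x
  proof (rule poly_mapping_eqI)
    fix i
    show "Poly_Mapping.lookup x i = Poly_Mapping.lookup 0 i"
    proof (cases "i < r")
      case True
      then have "f i \<in> b" using f by (auto simp: bij_betw_def)
      moreover have "\<forall>v\<in>b. Poly_Mapping.lookup x (g v) = 0"
      proof (rule ccontr)
        assume "\<not> ?thesis"
        then have "dependent b"
          using that(2) unfolding \<phi>_alt dependent_finite[OF b(1)]
          by (intro exI[of _ "\<lambda>v. Poly_Mapping.lookup x (g v)"]) simp
        with b(3) show False ..
      qed
      ultimately show ?thesis using g[OF True] by auto
    next
      case False
      with that(1) show ?thesis by (simp add: spE)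
    qed
  qed
  have "\<phi> ` F.span E = L"
  proof (intro set_eqI iffI)
    fix y assume "y \<in> L"
    then obtain u where y: "y = (\<Sum>v\<in>b. scale (u v) v)"
      unfolding b(4)[symmetric] span_finite[OF b(1)] by blast
    define w :: "(nat \<Rightarrow>\<^sub>0 int) \<Rightarrow> int"
      where "w v = (\<Sum>i<r. if v = frag_of i then u (f i) else 0)" for v
    have w: "w (frag_of i) = u (f i)" if "i < r" for i
      using that by (simp add: w_def frag_of_eq)
    define x where "x = (\<Sum>v\<in>E. frag_cmul (w v) v)"
    have "\<phi> x = (\<Sum>i<r. scale (u (f i)) (f i))"
      unfolding \<phi>_def x_def by (simp add: comb w)
    also have "\<dots> = y"
      unfolding y by (rule sum.reindex_bij_betw[OF f])
    finally show "y \<in> \<phi> ` F.span E"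
      unfolding x_def F.span_finite[OF cE(1)] by blast
  qed (use \<phi>_L in auto)
  moreover have "inj_on \<phi> (F.span E)"
  proof (rule inj_onI)
    fix x y assume xy: "x \<in> F.span E" "y \<in> F.span E" "\<phi> x = \<phi> y"
    have "\<phi> (x - y) + \<phi> y = \<phi> x" by (simp flip: \<phi>_add)
    with xy have "x - y = 0" by (intro \<phi>_0 F.span_diff) auto
    then show "x = y" by simp
  qed
  ultimately have "bij_betw \<phi> (F.span E) L"
    by (simp add: bij_betw_def)
  moreover have "Z_lattice frag_cmul (F.span E) r (\<lambda>x y. B (\<phi> x) (\<phi> y))"
  proof
    show "\<exists>b. finite b \<and> card b = r \<and> F.independent b \<and> F.span b = F.span E"
      using cE indE by blast
  qed (auto simp: \<phi>_add \<phi>_scale \<phi>_L add_left scale_left intro: sym pos_def dest: \<phi>_0)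
  ultimately show thesis by (rule that[rotated])
qed

lemma min_tight_rank_le:
  fixes scale :: "int \<Rightarrow> 'a::ab_group_add \<Rightarrow> 'a"
  assumes "Z_lattice scale L r B" and "tight_universal n L B"
  shows "min_tight_rank n \<le> enat r"
proof -
  obtain L' :: "(nat \<Rightarrow>\<^sub>0 int) set" and \<phi>
    where *: "Z_lattice frag_cmul L' r (\<lambda>x y. B (\<phi> x) (\<phi> y))" "bij_betw \<phi> L' L"
    using Z_lattice_transfer[OF assms(1)] .
  have "tight_universal n L' (\<lambda>x y. B (\<phi> x) (\<phi> y))"
    using assms(2) *(2) by (auto simp: tight_universal_def represented_by_def bij_betw_def)
  with *(1) show ?thesis
    unfolding min_tight_rank_def by (intro Inf_lower) blast
qed

end

theory Submission
  imports Defs "HOL-Computational_Algebra.Primes"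
begin

text \<open>
  Put \<open>s = \<lfloor>\<surd>n\<rfloor>\<close>, \<open>q = \<lfloor>(s - 1) / 2\<rfloor> + 2\<close> and \<open>h = \<lceil>n / 2\<rceil>\<close>, so that
  \<open>n \<le> s (s + 2) \<le> 2 s q\<close>.  On the integral vectors with even coordinate sum in the span of
  \<open>e\<^sub>0, a\<^sub>0, \<dots>, a\<^sub>s\<^sub>-\<^sub>1, b\<^sub>0, \<dots>, b\<^sub>q\<^sub>-\<^sub>1\<close> take the diagonal form with
  \<open>Q e\<^sub>0 = h\<close>, \<open>Q a\<^sub>i = h + i\<close>, \<open>Q b\<^sub>j = h + 2 s j\<close>, and add \<open>s\<close> times the square of half the
  coordinate sum.  A nonzero vector with even coordinate sum has coordinate squares summing to at
  least 2, so its value is at least \<open>2 h \<ge> n\<close>.  On the other hand \<open>a\<^sub>i - b\<^sub>j\<close> and \<open>a\<^sub>i + b\<^sub>j\<close> have the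
  values \<open>2 h + i + 2 s j\<close> and \<open>2 h + i + 2 s j + s\<close>, which fill the interval from \<open>2 h\<close> to
  \<open>2 h + 2 s q - 1\<close>.  Adding orthogonally \<open>n\<close> times a sum of four squares yields every multiple
  of \<open>n\<close>, and every other integer above \<open>n\<close>.
\<close>

subsection \<open>Lagrange's four-square theorem\<close>

definition sum_four_squares :: "int \<Rightarrow> bool" where
  "sum_four_squares m \<longleftrightarrow> (\<exists>a b c d. m = a\<^sup>2 + b\<^sup>2 + c\<^sup>2 + d\<^sup>2)"

lemma euler_four_square_identity:
  fixes a b c d :: "'a::comm_ring_1"
  shows "(a\<^sup>2 + b\<^sup>2 + c\<^sup>2 + d\<^sup>2) * (x\<^sup>2 + y\<^sup>2 + z\<^sup>2 + w\<^sup>2) =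
    (a * x + b * y + c * z + d * w)\<^sup>2 + (a * y - b * x + c * w - d * z)\<^sup>2 +
    (a * z - c * x + d * y - b * w)\<^sup>2 + (a * w - d * x + b * z - c * y)\<^sup>2"
  by (simp add: power2_eq_square algebra_simps)

lemma sum_four_squares_mult:
  "sum_four_squares m \<Longrightarrow> sum_four_squares k \<Longrightarrow> sum_four_squares (m * k)"
  unfolding sum_four_squares_def by (metis euler_four_square_identity)

section \<open>Descent on multiples that are sums of four squares\<close>

lemma ex_cong_abs_le_half:
  fixes m x :: int
  assumes "m > 0"
  shows "\<exists>y k. x = y + m * k \<and> 2 * \<bar>y\<bar> \<le> m"
proof (cases "2 * (x mod m) \<le> m")
  case True
  then show ?thesis
    using assms by (intro exI[of _ "x mod m"] exI[of _ "x div m"]) simp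
next
  case False
  have "x = (x mod m - m) + m * (x div m + 1)"
    by (simp add: algebra_simps)
  moreover have "2 * \<bar>x mod m - m\<bar> \<le> m"
    using False pos_mod_bound[OF assms, of x] by (auto simp: abs_if)
  ultimately show ?thesis by blast
qed

text \<open>Replacing \<open>a, b, c, d\<close> by their absolutely least residues modulo
  \<open>m\<close> gives a sum of squares \<open>m * m'\<close> with \<open>m' <= m\<close>. Euler's
  identity writes \<open>m * p * (m * m')\<close> as four squares whose bases are all divisible by
  \<open>m\<close>, so \<open>m^2\<close> cancels. The extremes \<open>m' = 0\<close> and
  \<open>m' = m\<close> would force \<open>m dvd p\<close>.\<close>

lemma four_squares_descent:
  fixes m p :: int
  assumes "m > 1" and ndvd: "\<not> m dvd p" and "sum_four_squares (m * p)"
  shows "\<exists>m'. 0 < m' \<and> m' < m \<and> sum_four_squares (m' * p)"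
proof -
  obtain a b c d where mp: "m * p = a\<^sup>2 + b\<^sup>2 + c\<^sup>2 + d\<^sup>2"
    using assms unfolding sum_four_squares_def by blast
  have m: "m > 0" using assms by simp
  obtain x k where a: "a = x + m * k" and x: "2 * \<bar>x\<bar> \<le> m" using ex_cong_abs_le_half[OF m] by blast
  obtain y l where b: "b = y + m * l" and y: "2 * \<bar>y\<bar> \<le> m" using ex_cong_abs_le_half[OF m] by blast
  obtain z i where c: "c = z + m * i" and z: "2 * \<bar>z\<bar> \<le> m" using ex_cong_abs_le_half[OF m] by blast
  obtain w j where d: "d = w + m * j" and w: "2 * \<bar>w\<bar> \<le> m" using ex_cong_abs_le_half[OF m] by blast
  define N where "N = x\<^sup>2 + y\<^sup>2 + z\<^sup>2 + w\<^sup>2"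
  \<comment> \<open>The squares of \<open>a, b, c, d\<close> exceed those of the residues by
    \<open>m * t\<close> in total, so \<open>m'\<close> is the quotient
    \<open>N / m\<close>.\<close>
  define t where "t = 2 * (x * k + y * l + z * i + w * j) + m * (k\<^sup>2 + l\<^sup>2 + i\<^sup>2 + j\<^sup>2)"
  define m' where "m' = p - t"
  have mpN: "m * p = N + m * t"
    unfolding mp a b c d N_def t_def by (simp add: power2_eq_square algebra_simps)
  then have N: "N = m * m'"
    by (simp add: m'_def algebra_simps)
  have sq: "4 * v\<^sup>2 \<le> m\<^sup>2" if "2 * \<bar>v\<bar> \<le> m" for v
    using power_mono[OF that, of 2] by (simp add: power_mult_distrib)
  have "N \<ge> 0" by (simp add: N_def)
  then have "m' \<ge> 0" using N m by (simp add: zero_le_mult_iff)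
  have "N \<noteq> 0"
  proof
    assume "N = 0"
    then have "x = 0 \<and> y = 0 \<and> z = 0 \<and> w = 0"
      using zero_le_power2[of x] zero_le_power2[of y] zero_le_power2[of z] zero_le_power2[of w]
      unfolding N_def by (smt (verit) power_eq_0_iff)
    then have "t = m * (k\<^sup>2 + l\<^sup>2 + i\<^sup>2 + j\<^sup>2)" by (simp add: t_def)
    moreover have "p = t" using \<open>N = 0\<close> mpN m by simp
    ultimately show False using ndvd by simp
  qed
  with N have "m' \<noteq> 0" by auto
  have "4 * N \<le> 4 * m\<^sup>2"
    using sq[OF x] sq[OF y] sq[OF z] sq[OF w] unfolding N_def by simp
  then have "m' \<le> m"
    using N m by (simp add: power2_eq_square)
  moreover have "m' \<noteq> m"
  proof
    assume "m' = m"
    then have "4 * N = 4 * m\<^sup>2" using N by (simp add: power2_eq_square)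
    \<comment> \<open>Equality in the sum forces equality in each of the four bounds, so every
      residue is plus or minus \<open>m / 2\<close>.\<close>
    then have "4 * x\<^sup>2 = m\<^sup>2 \<and> 4 * y\<^sup>2 = m\<^sup>2 \<and> 4 * z\<^sup>2 = m\<^sup>2 \<and> 4 * w\<^sup>2 = m\<^sup>2"
      using sq[OF x] sq[OF y] sq[OF z] sq[OF w] unfolding N_def by simp
    then have "(2 * x)\<^sup>2 = m\<^sup>2 \<and> (2 * y)\<^sup>2 = m\<^sup>2 \<and> (2 * z)\<^sup>2 = m\<^sup>2 \<and> (2 * w)\<^sup>2 = m\<^sup>2"
      by (simp add: power_mult_distrib)
    then have "m dvd 2 * x" "m dvd 2 * y" "m dvd 2 * z" "m dvd 2 * w"
      unfolding power2_eq_iff by (metis dvd_refl dvd_minus_iff)+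
    then have "m dvd 2 * x * k + 2 * y * l + 2 * z * i + 2 * w * j + m * (k\<^sup>2 + l\<^sup>2 + i\<^sup>2 + j\<^sup>2)"
      by (intro dvd_add) auto
    then have "m dvd t" by (simp add: t_def algebra_simps)
    then have "m dvd p" using \<open>m' = m\<close> unfolding m'_def by (metis dvd_refl diff_add_cancel dvd_add)
    with ndvd show False ..
  qed
  moreover have "sum_four_squares (m' * p)"
  proof -
    \<comment> \<open>These are the bases in Euler's identity divided by \<open>m\<close>: modulo
      \<open>m\<close> the first base is \<open>N\<close>, hence 0, and the other three cancel
      because \<open>a, b, c, d\<close> are congruent to \<open>x, y, z, w\<close>.\<close>
    define e where "e = m' + x * k + y * l + z * i + w * j"
    define f where "f = k * y - l * x + i * w - j * z"
    define g where "g = k * z - i * x + j * y - l * w"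
    define h where "h = k * w - j * x + l * z - i * y"
    have "m * p * N = (a * x + b * y + c * z + d * w)\<^sup>2 + (a * y - b * x + c * w - d * z)\<^sup>2 +
      (a * z - c * x + d * y - b * w)\<^sup>2 + (a * w - d * x + b * z - c * y)\<^sup>2"
      unfolding mp N_def by (rule euler_four_square_identity)
    also have "a * x + b * y + c * z + d * w = N + m * (x * k + y * l + z * i + w * j)"
      unfolding a b c d N_def by (simp add: power2_eq_square algebra_simps)
    also have "\<dots> = m * e" unfolding N e_def by (simp add: algebra_simps)
    also have "a * y - b * x + c * w - d * z = m * f"
      unfolding a b c d f_def by (simp add: algebra_simps)
    also have "a * z - c * x + d * y - b * w = m * g"
      unfolding a b c d g_def by (simp add: algebra_simps)
    also have "a * w - d * x + b * z - c * y = m * h"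
      unfolding a b c d h_def by (simp add: algebra_simps)
    finally have "m\<^sup>2 * (m' * p) = m\<^sup>2 * (e\<^sup>2 + f\<^sup>2 + g\<^sup>2 + h\<^sup>2)"
      unfolding N by (simp add: power2_eq_square algebra_simps)
    then show ?thesis
      using m unfolding sum_four_squares_def by auto
  qed
  ultimately show ?thesis
    using \<open>m' \<ge> 0\<close> \<open>m' \<noteq> 0\<close> by (intro exI[of _ m']) auto
qed

section \<open>Primes as sums of four squares\<close>

lemma inj_on_square_mod_prime:
  fixes p :: int
  assumes "prime p"
  shows "inj_on (\<lambda>x. x\<^sup>2 mod p) {x. 0 \<le> x \<and> 2 * x < p}"
proof (rule inj_onI)
  fix x y
  assume xy: "x \<in> {x. 0 \<le> x \<and> 2 * x < p}" "y \<in> {x. 0 \<le> x \<and> 2 * x < p}" "x\<^sup>2 mod p = y\<^sup>2 mod p"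
  have "p dvd x\<^sup>2 - y\<^sup>2"
    using xy(3) by (simp add: mod_eq_dvd_iff)
  then have "p dvd (x - y) * (x + y)"
    by (simp add: power2_eq_square algebra_simps)
  then have "p dvd x - y \<or> p dvd x + y"
    using assms by (simp add: prime_dvd_mult_iff)
  moreover have "x - y = 0" if "p dvd x - y"
    using dvd_imp_le_int[OF _ that] xy by fastforce
  moreover have "x + y = 0" if "p dvd x + y"
    using zdvd_imp_le[OF that] xy by fastforce
  ultimately show "x = y" using xy by auto
qed

text \<open>Pigeonhole: the residues of \<open>x^2\<close> and of \<open>-1 - y^2\<close> each fill
  \<open>(p + 1) / 2\<close> classes, which is \<open>p + 1\<close> in total, so two of them
  coincide.\<close>

lemma prime_dvd_sum_two_squares_plus_one:
  fixes p :: int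
  assumes p: "prime p" "odd p"
  shows "\<exists>x y. 0 \<le> x \<and> 2 * x < p \<and> 0 \<le> y \<and> 2 * y < p \<and> p dvd x\<^sup>2 + y\<^sup>2 + 1"
proof -
  obtain k where k: "p = 2 * k + 1" using p(2) by (elim oddE)
  have p0: "p > 0" using p(1) by (simp add: prime_gt_0_int)
  define S where "S = {x. 0 \<le> x \<and> 2 * x < p}"
  have S: "S = {0..k}" unfolding S_def k by auto
  define f where "f x = x\<^sup>2 mod p" for x
  define g where "g x = (- 1 - x\<^sup>2) mod p" for x
  have injf: "inj_on f S"
    using inj_on_square_mod_prime[OF p(1)] by (simp add: f_def[abs_def] S_def)
  have injg: "inj_on g S"
  proof (rule inj_onI)
    fix x y assume xy: "x \<in> S" "y \<in> S" "g x = g y"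
    have "p dvd (- 1 - x\<^sup>2) - (- 1 - y\<^sup>2)"
      using xy(3) by (simp only: g_def mod_eq_dvd_iff)
    then have "f x = f y"
      unfolding f_def mod_eq_dvd_iff by (simp add: dvd_diff_commute)
    with injf xy show "x = y" by (auto dest: inj_onD)
  qed
  have "f ` S \<inter> g ` S \<noteq> {}"
  proof
    assume *: "f ` S \<inter> g ` S = {}"
    have "card (f ` S \<union> g ` S) = card (f ` S) + card (g ` S)"
      by (intro card_Un_disjoint * finite_imageI) (simp_all add: S)
    also have "\<dots> = 2 * nat (k + 1)"
      using injf injg by (simp add: card_image S)
    finally have "card (f ` S \<union> g ` S) = 2 * nat (k + 1)" .
    moreover have "card (f ` S \<union> g ` S) \<le> card {0..<p}"
      using p0 by (intro card_mono) (auto simp: f_def g_def)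
    ultimately show False using k p0 by simp
  qed
  then obtain x y where xy: "x \<in> S" "y \<in> S" "f x = g y" by auto
  have "p dvd x\<^sup>2 - (- 1 - y\<^sup>2)"
    using xy(3) by (simp only: f_def g_def mod_eq_dvd_iff)
  then have "p dvd x\<^sup>2 + y\<^sup>2 + 1" by (simp add: algebra_simps)
  with xy show ?thesis unfolding S_def by blast
qed

lemma sum_four_squares_prime:
  fixes p :: int
  assumes p: "prime p"
  shows "sum_four_squares p"
proof (cases "odd p")
  case False
  then have "p = 2" using p by (metis dvd_refl primes_dvd_imp_eq two_is_prime_nat prime_int_numeral_eq)
  then have "p = 1\<^sup>2 + 1\<^sup>2 + 0\<^sup>2 + 0\<^sup>2" by simp
  then show ?thesis unfolding sum_four_squares_def by blast
next
  case True
  have p0: "p > 0" using p by (simp add: prime_gt_0_int)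
  define P where "P k \<longleftrightarrow> 0 < k \<and> int k < p \<and> sum_four_squares (int k * p)" for k
  obtain x y where xy: "0 \<le> x" "2 * x < p" "0 \<le> y" "2 * y < p" "p dvd x\<^sup>2 + y\<^sup>2 + 1"
    using prime_dvd_sum_two_squares_plus_one[OF p True] by blast
  obtain k where k: "x\<^sup>2 + y\<^sup>2 + 1 = p * k" using xy(5) by (elim dvdE)
  have "p * k > 0" unfolding k[symmetric] by (smt (verit) zero_le_power2)
  then have "k > 0" using p0 by (simp add: zero_less_mult_iff)
  have "(2 * x)\<^sup>2 < p\<^sup>2" "(2 * y)\<^sup>2 < p\<^sup>2"
    by (rule power_strict_mono; use xy in simp)+
  \<comment> \<open>Oddness gives \<open>p >= 3\<close>, so
    \<open>4 * (x^2 + y^2 + 1) < 2 * p^2 + 4 < 4 * p^2\<close>. The starting multiplier is thus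
    below \<open>p\<close>, and the least multiplier, if above 1, does not divide \<open>p\<close>
    and descends further.\<close>
  moreover have "p\<^sup>2 \<ge> 3\<^sup>2"
    using p True prime_ge_2_int[OF p] by (intro power_mono) (auto elim!: oddE)
  ultimately have "4 * (p * k) < 4 * p\<^sup>2"
    unfolding k[symmetric] by (simp add: power_mult_distrib)
  then have "k < p" using p0 by (simp add: power2_eq_square)
  have "k * p = x\<^sup>2 + y\<^sup>2 + 1\<^sup>2 + 0\<^sup>2" using k by (simp add: algebra_simps)
  then have "sum_four_squares (k * p)" unfolding sum_four_squares_def by blast
  then have "P (nat k)"
    using \<open>k > 0\<close> \<open>k < p\<close> by (simp add: P_def)
  then have least: "P (LEAST k. P k)" by (rule LeastI)
  define m where "m = (LEAST k. P k)"
  have m: "0 < m" "int m < p" "sum_four_squares (int m * p)"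
    using least unfolding m_def P_def by auto
  have "m = 1"
  proof (rule ccontr)
    assume "m \<noteq> 1"
    then have "int m > 1" using m(1) by simp
    moreover have "\<not> int m dvd p"
      using p m(2) \<open>int m > 1\<close> unfolding prime_int_iff by (metis less_irrefl of_nat_0_le_iff)
    ultimately obtain m' where m': "0 < m'" "m' < int m" "sum_four_squares (m' * p)"
      using four_squares_descent m(3) by blast
    then have "P (nat m')" using m(2) by (simp add: P_def)
    then have "m \<le> nat m'" unfolding m_def by (rule Least_le)
    with m' show False by simp
  qed
  with m(3) show ?thesis by simp
qed

lemma lagrange_four_squares:
  "\<exists>a b c d :: int. int m = a\<^sup>2 + b\<^sup>2 + c\<^sup>2 + d\<^sup>2"
proof -
  have "sum_four_squares (int m)"
  proof (induction m rule: prime_divisors_induct)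
    case zero
    have "int 0 = 0\<^sup>2 + 0\<^sup>2 + 0\<^sup>2 + 0\<^sup>2" by simp
    then show ?case unfolding sum_four_squares_def by blast
  next
    case (unit m)
    then have "int m = 1\<^sup>2 + 0\<^sup>2 + 0\<^sup>2 + 0\<^sup>2" by simp
    then show ?case unfolding sum_four_squares_def by blast
  next
    case (factor p m)
    then show ?case
      using sum_four_squares_mult[OF sum_four_squares_prime] by simp
  qed
  then show ?thesis unfolding sum_four_squares_def .
qed

subsection \<open>The lattices\<close>

lemma Z_lattice_coordinates:
  fixes B :: "(nat \<Rightarrow>\<^sub>0 int) \<Rightarrow> (nat \<Rightarrow>\<^sub>0 int) \<Rightarrow> int"
  defines "L r \<equiv> {x. \<forall>i\<ge>r. Poly_Mapping.lookup x i = 0}"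
  assumes "\<And>x y. B x y = B y x"
    and "\<And>x y z. B (x + y) z = B x z + B y z"
    and "\<And>c x y. B (frag_cmul c x) y = c * B x y"
    and "\<And>x. x \<in> L r \<Longrightarrow> x \<noteq> 0 \<Longrightarrow> B x x > 0"
  shows "Z_lattice frag_cmul (L r) r B"
proof -
  interpret F: module "frag_cmul :: int \<Rightarrow> (nat \<Rightarrow>\<^sub>0 int) \<Rightarrow> _" by (rule module_frag_cmul)
  define E where "E = (frag_of :: nat \<Rightarrow> nat \<Rightarrow>\<^sub>0 int) ` {..<r}"
  have inj: "inj_on (frag_of :: nat \<Rightarrow> nat \<Rightarrow>\<^sub>0 int) {..<r}"
    by (auto simp: inj_on_def frag_of_eq)
  have E: "finite E" "card E = r"
    using inj by (auto simp: E_def card_image)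
  have lookup: "Poly_Mapping.lookup (\<Sum>v\<in>E. frag_cmul (u v) v) i
      = (if i < r then u (frag_of i) else 0)" for u i
    unfolding E_def by (subst sum.reindex[OF inj]) (simp add: lookup_sum if_distrib cong: if_cong)
  have "F.independent E"
    unfolding F.dependent_finite[OF E(1)]
  proof (intro notI, elim exE conjE)
    fix u assume u: "\<exists>v\<in>E. u v \<noteq> 0" "(\<Sum>v\<in>E. frag_cmul (u v) v) = 0"
    then obtain i where "i < r" "u (frag_of i) \<noteq> 0" by (auto simp: E_def)
    with lookup[of u i] u(2) show False by simp
  qed
  moreover have "F.span E = L r"
  proof (intro set_eqI iffI)
    fix x assume "x \<in> F.span E"
    then show "x \<in> L r"
      unfolding F.span_finite[OF E(1)] by (auto simp: lookup L_def)
  next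
    fix x assume x: "x \<in> L r"
    define u where "u v = Poly_Mapping.lookup x (the_inv frag_of v)" for v :: "nat \<Rightarrow>\<^sub>0 int"
    have u: "u (frag_of i) = Poly_Mapping.lookup x i" for i
      unfolding u_def by (subst the_inv_f_f) (auto simp: inj_on_def frag_of_eq)
    have "x = (\<Sum>v\<in>E. frag_cmul (u v) v)"
      using x by (intro poly_mapping_eqI) (auto simp: lookup u L_def)
    then show "x \<in> F.span E"
      unfolding F.span_finite[OF E(1)] by blast
  qed
  ultimately show ?thesis
    using assms E by unfold_locales blast+
qed

text \<open>
  With \<open>x 0\<close> standing for half the coordinate sum, \<open>2 * x 0 - (\<Sum>l=1..k. x l)\<close> is the remaining
  coordinate of a point of \<open>\<int>\<^sup>k\<^sup>+\<^sup>1\<close> with even coordinate sum.  This makes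
  \<open>x 0, \<dots>, x k\<close> free coordinates of the lattice of such points.
\<close>

definition tight_form :: "int \<Rightarrow> int \<Rightarrow> (nat \<Rightarrow> int) \<Rightarrow> nat \<Rightarrow> int \<Rightarrow> (nat \<Rightarrow> int) \<Rightarrow> (nat \<Rightarrow> int) \<Rightarrow> int" where
  "tight_form s h w k n x y =
     s * x 0 * y 0 + h * (2 * x 0 - (\<Sum>l=1..k. x l)) * (2 * y 0 - (\<Sum>l=1..k. y l)) +
     (\<Sum>l=1..k. w l * x l * y l) + n * (\<Sum>t<4. x (k + 1 + t) * y (k + 1 + t))"

section \<open>Bilinearity, lower bound and values of the form\<close>

lemma tight_form_sym: "tight_form s h w k n x y = tight_form s h w k n y x"
  by (simp add: tight_form_def ac_simps)

lemma tight_form_add: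
  "tight_form s h w k n (\<lambda>i. x i + x' i) y = tight_form s h w k n x y + tight_form s h w k n x' y"
  by (simp add: tight_form_def sum.distrib algebra_simps)

lemma tight_form_scale: "tight_form s h w k n (\<lambda>i. c * x i) y = c * tight_form s h w k n x y"
  by (simp add: tight_form_def sum_distrib_left algebra_simps)

text \<open>This serves twice: for positive \<open>n\<close> it yields positive definiteness, and it
  excludes nonzero values below \<open>n\<close>.\<close>

lemma tight_form_ge:
  assumes "s \<ge> 0" "n \<ge> 0" "n \<le> 2 * h" and w: "\<And>l. 1 \<le> l \<Longrightarrow> l \<le> k \<Longrightarrow> h \<le> w l"
    and nz: "i < k + 5" "x i \<noteq> 0"
  shows "tight_form s h w k n x x \<ge> n"
proof -
  define D where "D = 2 * x 0 - (\<Sum>l=1..k. x l)"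
  \<comment> \<open>\<open>D\<close> is the eliminated coordinate, so \<open>S\<close> is the sum of
    squares of a point with even coordinate sum. \<open>C\<close> collects the four-square
    summand.\<close>
  define S where "S = D\<^sup>2 + (\<Sum>l=1..k. (x l)\<^sup>2)"
  define C where "C = (\<Sum>t<4. (x (k + 1 + t))\<^sup>2)"
  have h: "h \<ge> 0" using assms by simp
  have "S \<ge> 0" "C \<ge> 0" unfolding S_def C_def by (auto intro!: add_nonneg_nonneg sum_nonneg)
  have "h * (\<Sum>l=1..k. (x l)\<^sup>2) \<le> (\<Sum>l=1..k. w l * (x l)\<^sup>2)"
    unfolding sum_distrib_left using w by (intro sum_mono mult_right_mono) auto
  then have ge: "tight_form s h w k n x x \<ge> s * (x 0)\<^sup>2 + h * S + n * C"
    unfolding tight_form_def S_def C_def D_def[symmetric] power2_eq_square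
    by (simp add: algebra_simps)
  have "n \<le> h * S + n * C"
  proof (cases "C = 0")
    case False
    then have "n * 1 \<le> n * C" using \<open>C \<ge> 0\<close> assms by (intro mult_left_mono) auto
    moreover have "h * S \<ge> 0" using h \<open>S \<ge> 0\<close> by simp
    ultimately show ?thesis by simp
  next
    case True
    then have C0: "\<forall>t<4. x (k + 1 + t) = 0"
      unfolding C_def by (subst (asm) sum_nonneg_eq_0_iff) auto
    have "S \<noteq> 0"
    proof
      assume "S = 0"
      moreover have "(\<Sum>l=1..k. (x l)\<^sup>2) \<ge> 0" by (intro sum_nonneg) auto
      ultimately have "D\<^sup>2 = 0" "(\<Sum>l=1..k. (x l)\<^sup>2) = 0"
        unfolding S_def using zero_le_power2[of D] by linarith+
      then have "D = 0" and xl: "\<forall>l\<in>{1..k}. x l = 0"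
        by (simp_all add: sum_nonneg_eq_0_iff)
      then have "x 0 = 0" unfolding D_def by simp
      moreover have "i = 0 \<or> i \<in> {1..k} \<or> i - (k + 1) < 4 \<and> i = k + 1 + (i - (k + 1))"
        using nz(1) by auto
      ultimately show False using xl C0 nz(2) by metis
    qed
    moreover have "even S"
    proof -
      \<comment> \<open>Each \<open>y^2 + y\<close> is even, so \<open>S\<close> has the parity of
        the coordinate sum, which is \<open>2 * x 0\<close>.\<close>
      have "even (D\<^sup>2 + D + (\<Sum>l=1..k. (x l)\<^sup>2 + x l))"
        by (intro dvd_add[OF _ dvd_sum]) auto
      also have "D\<^sup>2 + D + (\<Sum>l=1..k. (x l)\<^sup>2 + x l) = S + 2 * x 0"
        by (simp add: S_def D_def sum.distrib)
      finally show ?thesis by simp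
    qed
    ultimately have "S \<ge> 2" using \<open>S \<ge> 0\<close> by presburger
    then have "h * 2 \<le> h * S" using h by (rule mult_left_mono)
    then show ?thesis using True assms by simp
  qed
  with ge show ?thesis using assms(1) by (smt (verit) mult_nonneg_nonneg zero_le_power2)
qed

lemma tight_form_tail_value:
  fixes c :: "nat \<Rightarrow> int"
  shows "\<exists>x. (\<forall>i\<ge>k+5. x i = 0) \<and> tight_form s h w k n x x = n * (\<Sum>t<4. (c t)\<^sup>2)"
proof (intro exI conjI allI impI)
  let ?x = "\<lambda>i. if i \<le> k \<or> i \<ge> k + 5 then 0 else c (i - (k + 1))"
  show "?x i = 0" if "i \<ge> k + 5" for i using that by simp
  show "tight_form s h w k n ?x ?x = n * (\<Sum>t<4. (c t)\<^sup>2)"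
    by (simp add: tight_form_def power2_eq_square)
qed

text \<open>The entries \<open>1\<close> and \<open>2 * d - 1\<close> at \<open>a\<close> and
  \<open>b\<close> sum to \<open>2 * d\<close>, twice the entry at 0. The eliminated coordinate
  therefore vanishes and no \<open>h\<close> term remains. The choices \<open>d = 0\<close> and
  \<open>d = 1\<close> give the difference and the sum of two basis vectors.\<close>

lemma tight_form_pair_value:
  fixes c :: "nat \<Rightarrow> int"
  assumes a: "a \<in> {1..k}" and b: "b \<in> {1..k}" and ab: "a \<noteq> b"
  shows "\<exists>x. (\<forall>i\<ge>k+5. x i = 0) \<and>
    tight_form s h w k n x x = s * d\<^sup>2 + w a + w b * (2 * d - 1)\<^sup>2 + n * (\<Sum>t<4. (c t)\<^sup>2)"
proof (intro exI conjI allI impI)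
  let ?x = "\<lambda>i. if i = 0 then d else if i = a then 1 else if i = b then 2 * d - 1
    else if i \<le> k \<or> i \<ge> k + 5 then 0 else c (i - (k + 1))"
  show "?x i = 0" if "i \<ge> k + 5" for i using that a b by auto
  have 1: "(\<Sum>l=1..k. ?x l) = 2 * d"
  proof -
    have "(\<Sum>l=1..k. ?x l) = (\<Sum>l=1..k. (if l = a then 1 else 0) + (if l = b then 2 * d - 1 else 0))"
      using ab by (intro sum.cong) auto
    also have "\<dots> = 2 * d" using a b by (simp add: sum.distrib)
    finally show ?thesis .
  qed
  have 2: "(\<Sum>l=1..k. w l * ?x l * ?x l) = w a + w b * (2 * d - 1)\<^sup>2"
  proof -
    have "(\<Sum>l=1..k. w l * ?x l * ?x l) =
        (\<Sum>l=1..k. (if l = a then w a else 0) + (if l = b then w b * (2 * d - 1)\<^sup>2 else 0))"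
      using ab by (intro sum.cong) (auto simp: power2_eq_square)
    also have "\<dots> = w a + w b * (2 * d - 1)\<^sup>2" using a b by (simp add: sum.distrib)
    finally show ?thesis .
  qed
  have 3: "(\<Sum>t<4. ?x (k + 1 + t) * ?x (k + 1 + t)) = (\<Sum>t<4. (c t)\<^sup>2)"
    using a b by (intro sum.cong) (auto simp: power2_eq_square)
  show "tight_form s h w k n ?x ?x = s * d\<^sup>2 + w a + w b * (2 * d - 1)\<^sup>2 + n * (\<Sum>t<4. (c t)\<^sup>2)"
    unfolding tight_form_def 1 2 3 by (simp add: power2_eq_square)
qed

section \<open>From the form to bounds on the minimal rank\<close>

lemma min_tight_rank_le_tight_form:
  assumes "n \<ge> 1" "s \<ge> 0" "int n \<le> 2 * h" and w: "\<And>l. 1 \<le> l \<Longrightarrow> l \<le> k \<Longrightarrow> h \<le> w l"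
    and rep: "\<And>m. n \<le> m \<Longrightarrow> \<exists>x. (\<forall>i\<ge>k+5. x i = 0) \<and> tight_form s h w k (int n) x x = int m"
  shows "min_tight_rank n \<le> enat (k + 5)"
proof (rule min_tight_rank_le)
  define B where "B x y = tight_form s h w k (int n) (Poly_Mapping.lookup x) (Poly_Mapping.lookup y)" for x y
  define L where "L = {x :: nat \<Rightarrow>\<^sub>0 int. \<forall>i\<ge>k+5. Poly_Mapping.lookup x i = 0}"
  have ge: "B x x \<ge> int n" if "x \<in> L" "x \<noteq> 0" for x
  proof -
    obtain i where i: "Poly_Mapping.lookup x i \<noteq> 0"
      using \<open>x \<noteq> 0\<close> by (auto simp: poly_mapping_eq_iff fun_eq_iff)
    then have "i < k + 5" using \<open>x \<in> L\<close> unfolding L_def by (auto simp: not_le[symmetric])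
    then show ?thesis
      unfolding B_def using i by (intro tight_form_ge[OF \<open>s \<ge> 0\<close> _ \<open>int n \<le> 2 * h\<close> w]) simp_all
  qed
  show "Z_lattice frag_cmul L (k + 5) B"
    unfolding L_def
  proof (rule Z_lattice_coordinates)
    show "B x y = B y x" for x y unfolding B_def by (rule tight_form_sym)
    show "B (x + y) z = B x z + B y z" for x y z
      unfolding B_def plus_poly_mapping.rep_eq by (rule tight_form_add)
    show "B (frag_cmul c x) y = c * B x y" for c x y
    proof -
      have "Poly_Mapping.lookup (frag_cmul c x) = (\<lambda>i. c * Poly_Mapping.lookup x i)" by auto
      then show ?thesis unfolding B_def by (simp only: tight_form_scale)
    qed
    show "B x x > 0" if "x \<in> {x. \<forall>i\<ge>k+5. Poly_Mapping.lookup x i = 0}" "x \<noteq> 0" for x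
      using ge[of x] that assms(1) by (simp add: L_def)
  qed
  \<comment> \<open>Hence a nonzero value comes from a nonzero vector, to which the lower bound
    applies.\<close>
  have "B 0 0 = 0" by (simp add: B_def tight_form_def)
  have "m \<ge> int n" if "m \<noteq> 0" "represented_by m L B" for m
    using that ge \<open>B 0 0 = 0\<close> unfolding represented_by_def by (cases "m = B 0 0") auto
  moreover have "represented_by m L B" if "m \<ge> int n" for m
  proof -
    obtain x where x: "\<forall>i\<ge>k+5. x i = 0" "tight_form s h w k (int n) x x = m"
      using rep[of "nat m"] \<open>m \<ge> int n\<close> by (auto simp: le_nat_iff)
    have "finite {i. x i \<noteq> 0}"
      by (rule finite_subset[of _ "{..<k+5}"]) (use x(1) in \<open>auto simp: not_le[symmetric]\<close>)
    then have "Poly_Mapping.lookup (Abs_poly_mapping x) = x" by simp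
    with x show ?thesis
      unfolding represented_by_def L_def B_def by (intro bexI[of _ "Abs_poly_mapping x"]) auto
  qed
  ultimately show "tight_universal n L B"
    unfolding tight_universal_def using assms(1) by fastforce
qed

lemma min_tight_rank_le_of_prod:
  assumes "n \<ge> 1" "n \<le> 2 * s * q"
  shows "min_tight_rank n \<le> enat (s + q + 5)"
proof -
  define h where "h = (n + 1) div 2"
  \<comment> \<open>Index \<open>i + 1\<close> carries \<open>a_i\<close> and index
    \<open>s + j + 1\<close> carries \<open>b_j\<close>; the vector \<open>e_0\<close> is the
    eliminated coordinate of weight \<open>h\<close>.\<close>
  define w where "w l = int (if l \<le> s then h + (l - 1) else h + 2 * s * (l - s - 1))" for l
  have "s > 0" using assms by (auto intro: gr0I)
  have four: "\<exists>c::nat \<Rightarrow> int. int m = (\<Sum>t<4. (c t)\<^sup>2)" for m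
  proof -
    obtain a b c d where "int m = a\<^sup>2 + b\<^sup>2 + c\<^sup>2 + d\<^sup>2" using lagrange_four_squares by blast
    then show ?thesis
      by (intro exI[of _ "(!) [a, b, c, d]"]) (simp add: eval_nat_numeral)
  qed
  show ?thesis
  proof (rule min_tight_rank_le_tight_form)
    show "int n \<le> 2 * int h" unfolding h_def by simp
    show "int h \<le> w l" for l by (simp add: w_def)
    fix m assume "n \<le> m"
    show "\<exists>x. (\<forall>i\<ge>s + q + 5. x i = 0) \<and> tight_form (int s) (int h) w (s + q) (int n) x x = int m"
    proof (cases "n dvd m")
      case True
      then obtain k where "m = n * k" by (elim dvdE)
      with four[of k] tight_form_tail_value[of "s + q"] show ?thesis by (metis of_nat_mult)
    next
      case False
      \<comment> \<open>\<open>n + m mod n\<close> is congruent to \<open>m\<close> and lies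
        strictly between \<open>n\<close> and \<open>2 * n\<close>. Since
        \<open>2 * h <= n + 1\<close>, the subtraction does not truncate. The mixed-radix digits
        \<open>j, d, i\<close> of \<open>v\<close> choose the pair of vectors and the sign.\<close>
      define v where "v = n + m mod n - 2 * h"
      define j where "j = v div (2 * s)"
      define d where "d = v mod (2 * s) div s"
      define i where "i = v mod (2 * s) mod s"
      have "m mod n > 0" using False by (simp add: mod_greater_zero_iff_not_dvd)
      moreover have "m mod n < n" using assms by simp
      ultimately have v: "n + m mod n = v + 2 * h" "v < n"
        unfolding v_def h_def by linarith+
      have "v < q * (2 * s)" using v(2) assms(2) by (simp add: ac_simps)
      then have "j < q" unfolding j_def by (rule less_mult_imp_div_less)
      have "i < s" unfolding i_def using \<open>s > 0\<close> by simp
      have "d < 2" unfolding d_def using \<open>s > 0\<close> by (intro less_mult_imp_div_less) simp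
      then have d: "d = 0 \<or> d = 1" by auto
      have "v = 2 * s * j + (s * d + i)"
        unfolding j_def d_def i_def by simp
      \<comment> \<open>One \<open>n\<close> is already spent in the pair value; the four-square
        summand supplies the other \<open>m div n - 1\<close> copies.\<close>
      moreover have "m = n * (m div n - 1) + (n + m mod n)"
      proof -
        have "m div n = Suc (m div n - 1)"
          using \<open>n \<le> m\<close> assms(1) by (simp add: div_greater_zero_iff)
        then have "n * (m div n) = n * (m div n - 1) + n"
          by (metis mult_Suc_right add.commute)
        then show ?thesis using mult_div_mod_eq[of n m] by linarith
      qed
      ultimately have m: "m = n * (m div n - 1) + (2 * s * j + (s * d + i) + 2 * h)"
        using v(1) by simp
      obtain c :: "nat \<Rightarrow> int" where c: "int (m div n - 1) = (\<Sum>t<4. (c t)\<^sup>2)" using four by blast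
      obtain x where x: "\<forall>i\<ge>s + q + 5. x i = 0"
        "tight_form (int s) (int h) w (s + q) (int n) x x =
          int s * (int d)\<^sup>2 + w (i + 1) + w (s + j + 1) * (2 * int d - 1)\<^sup>2 + int n * (\<Sum>t<4. (c t)\<^sup>2)"
        using tight_form_pair_value[of "i + 1" "s + q" "s + j + 1" "int s" "int h" w "int n" "int d" c]
          \<open>i < s\<close> \<open>j < q\<close> by auto
      have wa: "w (i + 1) = int (h + i)" "w (s + j + 1) = int (h + 2 * s * j)"
        unfolding w_def using \<open>i < s\<close> by auto
      \<comment> \<open>For \<open>d\<close> in {0, 1}, \<open>d^2 = d\<close> and
        \<open>(2 * d - 1)^2 = 1\<close>.\<close>
      have "tight_form (int s) (int h) w (s + q) (int n) x x =
        int (s * d + (h + i) + (h + 2 * s * j) + n * (m div n - 1))"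
        unfolding x(2) c[symmetric] wa using d by auto
      also have "s * d + (h + i) + (h + 2 * s * j) + n * (m div n - 1) = m"
        using m by linarith
      finally show ?thesis using x(1) by blast
    qed
  qed (use assms in auto)
qed

theorem theorem4p3:
  fixes n :: nat
  assumes "n \<ge> 1"
  shows "min_tight_rank n \<le>
    enat (nat (\<lfloor>(real_of_int \<lfloor>sqrt (real n)\<rfloor> - 1) / 2\<rfloor> + \<lfloor>sqrt (real n)\<rfloor> + 7))"
proof -
  define s where "s = nat \<lfloor>sqrt (real n)\<rfloor>"
  \<comment> \<open>For \<open>s >= 1\<close> this is the least \<open>q\<close> with
    \<open>2 * q >= s + 2\<close>.\<close>
  define q where "q = (s - 1) div 2 + 2"
  have s: "\<lfloor>sqrt (real n)\<rfloor> = int s" by (simp add: s_def)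
  have "s \<ge> 1" unfolding s_def using assms by (simp add: le_nat_iff le_floor_iff)
  have "sqrt (real n) < real (s + 1)" using s by linarith
  then have "real n < (real (s + 1))\<^sup>2"
    using real_sqrt_less_iff[of "real n" "(real (s + 1))\<^sup>2"] by simp
  then have "n < (s + 1)\<^sup>2" by (metis of_nat_less_iff of_nat_power)
  \<comment> \<open>By integrality \<open>n\<close> is at most \<open>(s + 1)^2 - 1\<close>, which
    factors as \<open>s * (s + 2)\<close>.\<close>
  then have "n \<le> s * (s + 2)" by (simp add: power2_eq_square)
  also have "\<dots> \<le> s * (2 * q)" unfolding q_def by (intro mult_left_mono) auto
  finally have "min_tight_rank n \<le> enat (s + q + 5)"
    using assms by (intro min_tight_rank_le_of_prod) (auto simp: ac_simps)
  moreover have "\<lfloor>(real_of_int \<lfloor>sqrt (real n)\<rfloor> - 1) / 2\<rfloor> = int ((s - 1) div 2)"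
  proof -
    have "\<lfloor>(real_of_int \<lfloor>sqrt (real n)\<rfloor> - 1) / 2\<rfloor> = \<lfloor>real_of_int (int (s - 1)) / real_of_int 2\<rfloor>"
      using \<open>s \<ge> 1\<close> unfolding s by (simp add: of_nat_diff)
    also have "\<dots> = int (s - 1) div 2" by (rule floor_divide_of_int_eq)
    finally show ?thesis by simp
  qed
  then have "nat (\<lfloor>(real_of_int \<lfloor>sqrt (real n)\<rfloor> - 1) / 2\<rfloor> + \<lfloor>sqrt (real n)\<rfloor> + 7) = s + q + 5"
    unfolding s q_def by simp
  ultimately show ?thesis by simp
qed

end
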